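(* Let $\Xi$ be a non-simple type, let $\{k_1,\ldots,k_s\}$ be the set of pairwise different white weights and $\{l_1,\ldots,l_t\}$ the set of pairwise different black weights occurring in $\Xi$, and suppose there are $m_i$ white vertices of weight $k_i$ ($i=1,\ldots,s$) and $n_j$ black vertices of weight $l_j$ ($j=1,\ldots,t$). Put $p=\prod_{i=1}^s m_i!\,\prod_{j=1}^t n_j!$. If the derivative type $\Xi'$ contains $N$ nonsymmetric w-trees and, for $i=2,3,\ldots$, $M_i$ w-trees with $i$-order symmetry, then $$|\Xi|=\frac{N}{p}+\sum_i\frac{iM_i}{p}.$$
   Context: A w-tree is a finite connected plane tree in which every vertex and every edge carries a positive integer weight, such that the weight of each vertex equals the sum of the weights of the edges incident to it; its vertices are properly 2-colored white and black. A type $\langle k_1,\ldots\,|\,l_1,\ldots\rangle$ (a list of white weights and a list of black weights with equal sums) is the set of w-trees with exactly the prescribed multiset of white vertex weights and of black vertex weights, up to orientation-preserving isotopy of the plane preserving colors and weights; $|\Xi|$ is the number of its elements. A type is simple if within each color all weights are pairwise distinct, and non-simple otherwise. The derivative type $\Xi'$ of $\Xi$ is obtained by labeling (numbering) the vertices, so that vertices of equal color and weight become distinguishable; its elements are w-trees of $\Xi$ with such a labeling, up to isotopy preserving colors, weights and labels. A w-tree of $\Xi'$ is nonsymmetric if the underlying (unlabeled) w-tree admits no nontrivial orientation-preserving self-homeomorphism of the plane preserving the tree, colors and weights, and it has $i$-order symmetry if the group of such symmetries of the underlying unlabeled w-tree has order $i$. *)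

theory Defs
  imports "HOL-Analysis.Analysis" "HOL-Library.Multiset"
begin

text \<open>
  The plane is the type \<^typ>\<open>complex\<close>. Vertices are points of the plane and edges are arcs,
  represented by their images. The two weight functions are only relevant on the vertices and
  on the edges, respectively.
\<close>

record wgraph =
  white :: "complex set"
  black :: "complex set"
  edges :: "complex set set"
  vweight :: "complex \<Rightarrow> nat"
  eweight :: "complex set \<Rightarrow> nat"

definition vertices :: "wgraph \<Rightarrow> complex set" where
  "vertices T = white T \<union> black T"

definition support :: "wgraph \<Rightarrow> complex set" where
  "support T = vertices T \<union> \<Union>(edges T)"

definition bicolored_plane_graph :: "wgraph \<Rightarrow> bool" where
  "bicolored_plane_graph T \<longleftrightarrow>
     finite (vertices T) \<and> vertices T \<noteq> {} \<and> white T \<inter> black T = {} \<and> finite (edges T) \<and>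
     (\<forall>e\<in>edges T. \<exists>g. arc g \<and> path_image g = e \<and>
        pathstart g \<in> white T \<and> pathfinish g \<in> black T \<and>
        e \<inter> vertices T = {pathstart g, pathfinish g}) \<and>
     (\<forall>e\<in>edges T. \<forall>e'\<in>edges T. e \<noteq> e' \<longrightarrow> e \<inter> e' \<subseteq> vertices T)"

text \<open>For a finite plane graph, being a tree (connected and without cycles) means that its
  support is connected and contains no simple closed curve.\<close>

definition bicolored_plane_tree :: "wgraph \<Rightarrow> bool" where
  "bicolored_plane_tree T \<longleftrightarrow>
     bicolored_plane_graph T \<and> connected (support T) \<and>
     \<not> (\<exists>g. simple_path g \<and> pathfinish g = pathstart g \<and> path_image g \<subseteq> support T)"

definition wtree :: "wgraph \<Rightarrow> bool" where
  "wtree T \<longleftrightarrow>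
     bicolored_plane_tree T \<and>
     (\<forall>v\<in>vertices T. vweight T v > 0) \<and>
     (\<forall>e\<in>edges T. eweight T e > 0) \<and>
     (\<forall>v\<in>vertices T. vweight T v = (\<Sum>e | e \<in> edges T \<and> v \<in> e. eweight T e))"

text \<open>An isotopy of the plane is a level-preserving self-homeomorphism of
  $[0,1] \times \mathbb{C}$ that starts at the identity. A self-homeomorphism of the plane
  preserves orientation iff it is the end of such an isotopy; this is taken as the definition,
  so that isotopy of trees and symmetries of a tree refer to the same group of maps.\<close>

definition plane_isotopy :: "(real \<Rightarrow> complex \<Rightarrow> complex) \<Rightarrow> bool" where
  "plane_isotopy H \<longleftrightarrow>
     H 0 = id \<and>
     (\<exists>G. homeomorphism ({0..1} \<times> UNIV) ({0..1} \<times> UNIV) (\<lambda>(t, z). (t, H t z)) G)"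

definition orientation_preserving_homeo :: "(complex \<Rightarrow> complex) \<Rightarrow> bool" where
  "orientation_preserving_homeo h \<longleftrightarrow> (\<exists>H. plane_isotopy H \<and> H 1 = h)"

definition carries :: "(complex \<Rightarrow> complex) \<Rightarrow> wgraph \<Rightarrow> wgraph \<Rightarrow> bool" where
  "carries h T T' \<longleftrightarrow>
     h ` white T = white T' \<and> h ` black T = black T' \<and> (`) h ` edges T = edges T' \<and>
     (\<forall>v\<in>vertices T. vweight T' (h v) = vweight T v) \<and>
     (\<forall>e\<in>edges T. eweight T' (h ` e) = eweight T e)"

definition is_type :: "nat multiset \<Rightarrow> nat multiset \<Rightarrow> bool" where
  "is_type K L \<longleftrightarrow>
     K \<noteq> {#} \<and> L \<noteq> {#} \<and> (\<forall>k\<in>#K. k > 0) \<and> (\<forall>l\<in>#L. l > 0) \<and> sum_mset K = sum_mset L"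

definition simple_type :: "nat multiset \<Rightarrow> nat multiset \<Rightarrow> bool" where
  "simple_type K L \<longleftrightarrow> (\<forall>k\<in>#K. count K k = 1) \<and> (\<forall>l\<in>#L. count L l = 1)"

definition wtrees_of_type :: "nat multiset \<Rightarrow> nat multiset \<Rightarrow> wgraph set" where
  "wtrees_of_type K L =
     {T. wtree T \<and> image_mset (vweight T) (mset_set (white T)) = K \<and>
         image_mset (vweight T) (mset_set (black T)) = L}"

definition isotopic :: "wgraph \<Rightarrow> wgraph \<Rightarrow> bool" where
  "isotopic T T' \<longleftrightarrow> (\<exists>h. orientation_preserving_homeo h \<and> carries h T T')"

definition type_classes :: "nat multiset \<Rightarrow> nat multiset \<Rightarrow> wgraph set set" where
  "type_classes K L =
     wtrees_of_type K L //
       {(T, T'). T \<in> wtrees_of_type K L \<and> T' \<in> wtrees_of_type K L \<and> isotopic T T'}"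

text \<open>Vertices are numbered separately within each group of equal color and weight. Labels of
  points that are not vertices are irrelevant.\<close>

definition labeling :: "wgraph \<Rightarrow> (complex \<Rightarrow> nat) \<Rightarrow> bool" where
  "labeling T lab \<longleftrightarrow>
     (\<forall>k. bij_betw lab {v \<in> white T. vweight T v = k} {1..card {v \<in> white T. vweight T v = k}}) \<and>
     (\<forall>k. bij_betw lab {v \<in> black T. vweight T v = k} {1..card {v \<in> black T. vweight T v = k}})"

type_synonym labeled_wgraph = "wgraph \<times> (complex \<Rightarrow> nat)"

definition labeled_wtrees_of_type :: "nat multiset \<Rightarrow> nat multiset \<Rightarrow> labeled_wgraph set" where
  "labeled_wtrees_of_type K L = {(T, lab). T \<in> wtrees_of_type K L \<and> labeling T lab}"

definition labeled_isotopic :: "labeled_wgraph \<Rightarrow> labeled_wgraph \<Rightarrow> bool" where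
  "labeled_isotopic X X' \<longleftrightarrow>
     (\<exists>h. orientation_preserving_homeo h \<and> carries h (fst X) (fst X') \<and>
          (\<forall>v\<in>vertices (fst X). snd X' (h v) = snd X v))"

definition derivative_type :: "nat multiset \<Rightarrow> nat multiset \<Rightarrow> labeled_wgraph set set" where
  "derivative_type K L =
     labeled_wtrees_of_type K L //
       {(X, X'). X \<in> labeled_wtrees_of_type K L \<and> X' \<in> labeled_wtrees_of_type K L \<and>
                 labeled_isotopic X X'}"

text \<open>A symmetry is what a homeomorphism does to the vertices and edges: homeomorphisms that
  induce the same permutations of vertices and edges count as the same symmetry.\<close>

definition symmetries ::
  "wgraph \<Rightarrow> ((complex \<Rightarrow> complex) \<times> (complex set \<Rightarrow> complex set)) set" where
  "symmetries T =
     {(restrict h (vertices T), restrict ((`) h) (edges T)) |h.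
        orientation_preserving_homeo h \<and> carries h T T}"

definition nonsymmetric :: "wgraph \<Rightarrow> bool" where
  "nonsymmetric T \<longleftrightarrow>
     (\<forall>h. orientation_preserving_homeo h \<and> carries h T T \<longrightarrow>
          (\<forall>v\<in>vertices T. h v = v) \<and> (\<forall>e\<in>edges T. h ` e = e))"

text \<open>Both conditions below depend only on the isotopy class of the underlying w-tree, so it
  makes no difference whether all representatives or just one of them is considered.\<close>

definition nonsymmetric_elements :: "nat multiset \<Rightarrow> nat multiset \<Rightarrow> labeled_wgraph set set" where
  "nonsymmetric_elements K L = {C \<in> derivative_type K L. \<forall>(T, lab)\<in>C. nonsymmetric T}"

definition symmetric_elements ::
  "nat \<Rightarrow> nat multiset \<Rightarrow> nat multiset \<Rightarrow> labeled_wgraph set set" where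
  "symmetric_elements i K L = {C \<in> derivative_type K L. \<forall>(T, lab)\<in>C. card (symmetries T) = i}"

end

theory Submission
  imports Defs
begin

text \<open>
  In a plane tree an edge is determined by its end points, so a symmetry is determined by the
  permutation of the vertices that it induces. The symmetry group of a w-tree $T$ therefore acts
  freely on the $p$ labelings of $T$, and exactly $p / |\mathrm{Sym}(T)|$ elements of the
  derivative type lie over the class of $T$. Weighting every element of the derivative type by the
  order of its symmetry group thus gives every class of w-trees the total weight $p$. Finiteness
  of the type comes from the finiteness of the counted sets, as the orders of symmetry groups are
  at most $p$.
\<close>

section \<open>Group structure of the orientation-preserving homeomorphisms\<close>

lemma orientation_preserving_homeo_id: "orientation_preserving_homeo id"
proof -
  have "homeomorphism ({0..1::real} \<times> (UNIV::complex set)) ({0..1} \<times> UNIV) (\<lambda>(t, z). (t, id z)) (\<lambda>x. x)"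
    by (simp add: homeomorphism_def case_prod_beta)
  then show ?thesis
    unfolding orientation_preserving_homeo_def plane_isotopy_def
    by (intro exI[of _ "\<lambda>_. id"]) auto
qed

text \<open>Isotopies compose level by level: the maps \<open>(t, z) \<mapsto> (t, H t z)\<close> on
  the strip compose to a map of the same form.\<close>

lemma orientation_preserving_homeo_comp:
  assumes "orientation_preserving_homeo h" "orientation_preserving_homeo k"
  shows "orientation_preserving_homeo (k \<circ> h)"
proof -
  let ?S = "{0..1::real} \<times> (UNIV::complex set)"
  obtain H G where H: "H 0 = id" "H 1 = h" "homeomorphism ?S ?S (\<lambda>(t, z). (t, H t z)) G"
    using assms(1) unfolding orientation_preserving_homeo_def plane_isotopy_def by blast
  obtain H' G' where H': "H' 0 = id" "H' 1 = k" "homeomorphism ?S ?S (\<lambda>(t, z). (t, H' t z)) G'"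
    using assms(2) unfolding orientation_preserving_homeo_def plane_isotopy_def by blast
  have "(\<lambda>(t, z). (t, H' t z)) \<circ> (\<lambda>(t, z). (t, H t z)) = (\<lambda>(t, z). (t, (H' t \<circ> H t) z))"
    by auto
  with homeomorphism_compose[OF H(3) H'(3)]
  have "homeomorphism ?S ?S (\<lambda>(t, z). (t, (H' t \<circ> H t) z)) (G \<circ> G')"
    by simp
  then show ?thesis
    unfolding orientation_preserving_homeo_def plane_isotopy_def
    using H(1,2) H'(1,2) by (intro exI[of _ "\<lambda>t. H' t \<circ> H t"]) auto
qed

text \<open>The inverse of a level-preserving homeomorphism of the strip preserves levels as well,
  so its second component is an isotopy, and this isotopy ends at the inverse of
  \<open>h\<close>.\<close>

lemma orientation_preserving_homeo_inverse:
  assumes "orientation_preserving_homeo h"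
  obtains k where "orientation_preserving_homeo k" "k \<circ> h = id" "h \<circ> k = id"
proof -
  let ?S = "{0..1::real} \<times> (UNIV::complex set)"
  obtain H G where H: "H 0 = id" "H 1 = h" and
    hom: "homeomorphism ?S ?S (\<lambda>(t, z). (t, H t z)) G"
    using assms unfolding orientation_preserving_homeo_def plane_isotopy_def by blast
  have GF: "G (t, H t z) = (t, z)" if "t \<in> {0..1}" for t z
    using homeomorphism_apply1[OF hom, of "(t, z)"] that by auto
  have FG: "fst (G (t, z)) = t \<and> H t (snd (G (t, z))) = z" if "t \<in> {0..1}" for t z
    using homeomorphism_apply2[OF hom, of "(t, z)"] that by (auto simp: case_prod_beta)
  define H' where "H' t z = snd (G (t, z))" for t z
  \<comment> \<open>On the strip the map built from \<open>H'\<close> is \<open>G\<close> itself,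
    because \<open>FG\<close> shows that \<open>G\<close> keeps the level \<open>t\<close>.\<close>
  have "homeomorphism ?S ?S (\<lambda>(t, z). (t, H' t z)) (\<lambda>(t, z). (t, H t z))"
  proof (rule homeomorphism_cong[OF homeomorphism_symD[OF hom]])
    show "(case x of (t, z) \<Rightarrow> (t, H' t z)) = G x" if "x \<in> ?S" for x
      using that FG[of "fst x" "snd x"] by (auto simp: H'_def prod_eq_iff case_prod_beta)
  qed auto
  moreover have "H' 0 = id"
    using GF[of 0] H(1) by (auto simp: H'_def fun_eq_iff)
  ultimately have "orientation_preserving_homeo (H' 1)"
    unfolding orientation_preserving_homeo_def plane_isotopy_def by blast
  moreover have "H' 1 \<circ> h = id" "h \<circ> H' 1 = id"
    using GF[of 1] FG[of 1] H(2) by (auto simp: H'_def fun_eq_iff)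
  ultimately show ?thesis
    by (rule that)
qed

section \<open>Isotopy of plain and of labeled w-trees as an equivalence relation\<close>

lemma carries_id: "carries id T T"
  by (simp add: carries_def)

lemma carries_vertices: "carries h T T' \<Longrightarrow> h ` vertices T = vertices T'"
  by (simp add: carries_def vertices_def image_Un)

lemma carries_comp:
  assumes "carries h T T'" "carries k T' T''"
  shows "carries (k \<circ> h) T T''"
proof -
  have "(`) (k \<circ> h) ` edges T = (`) k ` (`) h ` edges T"
    by (simp add: image_comp comp_def)
  moreover have "h v \<in> vertices T'" if "v \<in> vertices T" for v
    using carries_vertices[OF assms(1)] that by blast
  moreover have "h ` e \<in> edges T'" if "e \<in> edges T" for e
    using assms(1) that by (auto simp: carries_def)
  ultimately show ?thesis
    using assms by (simp add: carries_def flip: image_image)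
qed

lemma carries_inverse:
  assumes "carries h T T'" "k \<circ> h = id"
  shows "carries k T' T"
proof -
  have kh: "k (h x) = x" for x
    using assms(2) by (simp add: fun_eq_iff)
  have khi: "k ` h ` X = X" for X
    by (simp add: image_image kh)
  have [simp]: "white T' = h ` white T" "black T' = h ` black T" "edges T' = (`) h ` edges T"
    "vertices T' = h ` vertices T"
    using assms(1) carries_vertices[OF assms(1)] by (auto simp: carries_def)
  show ?thesis
    using assms(1) unfolding carries_def by (simp add: khi kh image_image)
qed

lemma equiv_isotopic:
  "equiv (wtrees_of_type K L)
     {(T, T'). T \<in> wtrees_of_type K L \<and> T' \<in> wtrees_of_type K L \<and> isotopic T T'}"
proof (rule equivI)
  have "isotopic T T" for T
    unfolding isotopic_def using orientation_preserving_homeo_id carries_id by blast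
  then show "refl_on (wtrees_of_type K L)
     {(T, T'). T \<in> wtrees_of_type K L \<and> T' \<in> wtrees_of_type K L \<and> isotopic T T'}"
    by (auto simp: refl_on_def)
  have "isotopic T' T" if "isotopic T T'" for T T'
    using that unfolding isotopic_def
    by (metis orientation_preserving_homeo_inverse carries_inverse)
  then show "sym {(T, T'). T \<in> wtrees_of_type K L \<and> T' \<in> wtrees_of_type K L \<and> isotopic T T'}"
    by (auto simp: sym_def)
  have "isotopic T T''" if "isotopic T T'" "isotopic T' T''" for T T' T''
    using that unfolding isotopic_def
    by (metis orientation_preserving_homeo_comp carries_comp)
  then show "trans {(T, T'). T \<in> wtrees_of_type K L \<and> T' \<in> wtrees_of_type K L \<and> isotopic T T'}"
    unfolding trans_def by blast
qed auto

lemma labeled_isotopic_refl: "labeled_isotopic X X"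
  unfolding labeled_isotopic_def
  using orientation_preserving_homeo_id carries_id by (intro exI[of _ id]) auto

lemma labeled_isotopic_sym:
  assumes "labeled_isotopic X X'"
  shows "labeled_isotopic X' X"
proof -
  obtain h where h: "orientation_preserving_homeo h" "carries h (fst X) (fst X')"
    "\<forall>v\<in>vertices (fst X). snd X' (h v) = snd X v"
    using assms by (auto simp: labeled_isotopic_def)
  obtain k where k: "orientation_preserving_homeo k" "k \<circ> h = id" "h \<circ> k = id"
    using orientation_preserving_homeo_inverse[OF h(1)] .
  have "snd X (k w) = snd X' w" if w: "w \<in> vertices (fst X')" for w
  proof -
    obtain v where "v \<in> vertices (fst X)" "w = h v"
      using w unfolding carries_vertices[OF h(2), symmetric] by (elim imageE) (rule that)
    then show ?thesis
      using h(3) k(2) by (simp add: fun_eq_iff)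
  qed
  then show ?thesis
    unfolding labeled_isotopic_def using k(1) carries_inverse[OF h(2) k(2)] by blast
qed

lemma labeled_isotopic_trans:
  assumes "labeled_isotopic X X'" "labeled_isotopic X' X''"
  shows "labeled_isotopic X X''"
proof -
  obtain h where h: "orientation_preserving_homeo h" "carries h (fst X) (fst X')"
    "\<forall>v\<in>vertices (fst X). snd X' (h v) = snd X v"
    using assms(1) by (auto simp: labeled_isotopic_def)
  obtain k where k: "orientation_preserving_homeo k" "carries k (fst X') (fst X'')"
    "\<forall>v\<in>vertices (fst X'). snd X'' (k v) = snd X' v"
    using assms(2) by (auto simp: labeled_isotopic_def)
  have "\<forall>v\<in>vertices (fst X). snd X'' ((k \<circ> h) v) = snd X v"
    using h(3) k(3) carries_vertices[OF h(2)] by (metis comp_apply imageI)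
  then show ?thesis
    unfolding labeled_isotopic_def
    using orientation_preserving_homeo_comp[OF h(1) k(1)] carries_comp[OF h(2) k(2)] by blast
qed

lemma equiv_labeled_isotopic:
  "equiv (labeled_wtrees_of_type K L)
     {(X, X'). X \<in> labeled_wtrees_of_type K L \<and> X' \<in> labeled_wtrees_of_type K L \<and>
        labeled_isotopic X X'}"
proof (rule equivI)
  show "refl_on (labeled_wtrees_of_type K L)
     {(X, X'). X \<in> labeled_wtrees_of_type K L \<and> X' \<in> labeled_wtrees_of_type K L \<and>
        labeled_isotopic X X'}"
    using labeled_isotopic_refl by (auto simp: refl_on_def)
  show "sym {(X, X'). X \<in> labeled_wtrees_of_type K L \<and> X' \<in> labeled_wtrees_of_type K L \<and>
        labeled_isotopic X X'}"
    using labeled_isotopic_sym by (auto simp: sym_def)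
  show "trans {(X, X'). X \<in> labeled_wtrees_of_type K L \<and> X' \<in> labeled_wtrees_of_type K L \<and>
        labeled_isotopic X X'}"
    using labeled_isotopic_trans unfolding trans_def by blast
qed auto

section \<open>Symmetries as permutations of the vertices\<close>

text \<open>Two different edges with the same ends would form a simple closed curve: run along one
  and return along the other.\<close>

lemma wtree_edge_determined_by_ends:
  assumes "wtree T" "e \<in> edges T" "e' \<in> edges T" "e \<inter> vertices T = e' \<inter> vertices T"
  shows "e = e'"
proof (rule ccontr)
  assume "e \<noteq> e'"
  have tree: "bicolored_plane_graph T" and acyclic:
    "\<not> (\<exists>g. simple_path g \<and> pathfinish g = pathstart g \<and> path_image g \<subseteq> support T)"
    using assms(1) by (auto simp: wtree_def bicolored_plane_tree_def)
  have sub: "e \<inter> e' \<subseteq> vertices T" and disj: "white T \<inter> black T = {}"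
    using tree assms(2,3) \<open>e \<noteq> e'\<close> by (auto simp: bicolored_plane_graph_def)
  have arcs: "\<forall>e\<in>edges T. \<exists>g. arc g \<and> path_image g = e \<and>
      pathstart g \<in> white T \<and> pathfinish g \<in> black T \<and>
      e \<inter> vertices T = {pathstart g, pathfinish g}"
    using tree by (simp add: bicolored_plane_graph_def)
  obtain g where g: "arc g" "path_image g = e" "pathstart g \<in> white T" "pathfinish g \<in> black T"
    "e \<inter> vertices T = {pathstart g, pathfinish g}"
    using bspec[OF arcs assms(2)] by (elim exE conjE) (rule that)
  obtain g' where g': "arc g'" "path_image g' = e'" "pathstart g' \<in> white T"
    "pathfinish g' \<in> black T" "e' \<inter> vertices T = {pathstart g', pathfinish g'}"
    using bspec[OF arcs assms(3)] by (elim exE conjE) (rule that)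
  have "{pathstart g, pathfinish g} = {pathstart g', pathfinish g'}"
    using g(5) g'(5) assms(4) by simp
  \<comment> \<open>Both arcs run from white to black, so equality of the unordered pairs of ends
    matches start with start and finish with finish.\<close>
  then have ends: "pathstart g = pathstart g'" "pathfinish g = pathfinish g'"
    using g(3,4) g'(3,4) disj by (auto simp: doubleton_eq_iff)
  have "simple_path (g +++ reversepath g')"
  proof (rule simple_path_join_loop)
    show "path_image g \<inter> path_image (reversepath g') \<subseteq> {pathstart g, pathstart (reversepath g')}"
      using sub g(2,5) g'(2) ends by auto
  qed (use g(1) g'(1) ends in \<open>simp_all add: arc_reversepath\<close>)
  moreover have "path_image (g +++ reversepath g') \<subseteq> support T"
    using g(2) g'(2) ends assms(2,3) by (auto simp: path_image_join support_def)
  moreover have "pathfinish (g +++ reversepath g') = pathstart (g +++ reversepath g')"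
    using ends by simp
  ultimately show False
    using acyclic by blast
qed

text \<open>The vertex components of \<open>symmetries T\<close>. Labels see only this part of a
  symmetry, so it is this set that acts on labelings.\<close>

definition vertex_symmetries :: "wgraph \<Rightarrow> (complex \<Rightarrow> complex) set" where
  "vertex_symmetries T =
     {restrict h (vertices T) |h. orientation_preserving_homeo h \<and> carries h T T}"

text \<open>Both maps are injective and permute the vertices, so they send the ends of
  \<open>e\<close> to the ends of the image edges; these agree, and the ends determine an
  edge.\<close>

lemma carries_edges_eqI:
  assumes "wtree T" "orientation_preserving_homeo h" "carries h T T"
    "orientation_preserving_homeo k" "carries k T T"
    "\<And>v. v \<in> vertices T \<Longrightarrow> h v = k v" "e \<in> edges T"
  shows "h ` e = k ` e"
proof (rule wtree_edge_determined_by_ends[OF assms(1)])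
  show "h ` e \<in> edges T" "k ` e \<in> edges T"
    using assms(3,5,7) by (auto simp: carries_def)
  have ends: "f ` e \<inter> vertices T = f ` (e \<inter> vertices T)"
    if "orientation_preserving_homeo f" "carries f T T" for f
  proof -
    have "inj f"
      using orientation_preserving_homeo_inverse[OF that(1)]
      by (metis inj_on_id inj_on_imageI2)
    then show ?thesis
      by (metis carries_vertices[OF that(2)] image_Int)
  qed
  have "h ` (e \<inter> vertices T) = k ` (e \<inter> vertices T)"
    using assms(6) by auto
  then show "h ` e \<inter> vertices T = k ` e \<inter> vertices T"
    using ends[OF assms(2,3)] ends[OF assms(4,5)] by simp
qed

text \<open>Forgetting the edge component of a symmetry is injective, since the action on vertices
  determines the action on edges.\<close>

lemma card_symmetries:
  assumes "wtree T"
  shows "card (symmetries T) = card (vertex_symmetries T)"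
proof -
  have "inj_on fst (symmetries T)"
  proof (rule inj_onI)
    fix x y
    assume "x \<in> symmetries T" "y \<in> symmetries T" and fst_eq: "fst x = fst y"
    then obtain h k
      where h: "orientation_preserving_homeo h" "carries h T T"
          "x = (restrict h (vertices T), restrict ((`) h) (edges T))"
        and k: "orientation_preserving_homeo k" "carries k T T"
          "y = (restrict k (vertices T), restrict ((`) k) (edges T))"
      unfolding symmetries_def by blast
    have "h v = k v" if "v \<in> vertices T" for v
      using fun_cong[OF fst_eq[unfolded h(3) k(3) fst_conv], of v] that by simp
    then have "h ` e = k ` e" if "e \<in> edges T" for e
      using carries_edges_eqI[OF assms h(1,2) k(1,2)] that by blast
    then show "x = y"
      using fst_eq unfolding h(3) k(3) by (auto simp: fun_eq_iff restrict_apply)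
  qed
  moreover have "fst ` symmetries T = vertex_symmetries T"
    unfolding symmetries_def vertex_symmetries_def by (auto simp: image_def)
  ultimately show ?thesis
    by (metis card_image)
qed

text \<open>This makes nonsymmetric trees the case of order 1, so that they can be counted uniformly
  with the symmetric ones. The identity is always a symmetry, and \<open>card\<close> is 0 on
  infinite sets, so cardinality 1 means that it is the only one.\<close>

lemma nonsymmetric_iff_card_symmetries:
  "nonsymmetric T \<longleftrightarrow> card (symmetries T) = 1"
proof -
  define u where "u = (restrict id (vertices T), restrict ((`) id) (edges T))"
  have u: "u \<in> symmetries T"
    unfolding u_def symmetries_def using orientation_preserving_homeo_id carries_id by blast
  have "nonsymmetric T \<longleftrightarrow> (\<forall>x\<in>symmetries T. x = u)"
  proof -
    have "(\<forall>v\<in>vertices T. h v = v) \<and> (\<forall>e\<in>edges T. h ` e = e) \<longleftrightarrow>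
        (restrict h (vertices T), restrict ((`) h) (edges T)) = u" for h
      unfolding u_def prod.inject by (simp add: fun_eq_iff restrict_apply) blast
    moreover have "(\<forall>x\<in>symmetries T. x = u) \<longleftrightarrow>
        (\<forall>h. orientation_preserving_homeo h \<and> carries h T T \<longrightarrow>
          (restrict h (vertices T), restrict ((`) h) (edges T)) = u)"
      unfolding symmetries_def by blast
    ultimately show ?thesis
      unfolding nonsymmetric_def by simp
  qed
  also have "\<dots> \<longleftrightarrow> symmetries T = {u}"
    using u by blast
  also have "\<dots> \<longleftrightarrow> card (symmetries T) = 1"
    using u by (metis card_1_singletonE is_singletonI is_singleton_altdef singletonD)
  finally show ?thesis .
qed

section \<open>Counting the labelings of a w-tree\<close>

text \<open>Values off the vertices are arbitrary in \<open>labeling\<close>; extensionality picks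
  one function for each numbering of the vertices and so makes counting meaningful.\<close>

definition vertex_labelings :: "wgraph \<Rightarrow> (complex \<Rightarrow> nat) set" where
  "vertex_labelings T = {lab \<in> extensional (vertices T). labeling T lab}"

text \<open>An injection between finite sets of equal size is onto, so the count of injections
  applies; its falling product is the factorial.\<close>

lemma card_bijections_onto_initial_segment:
  assumes "finite A"
  shows "card {f \<in> extensional A. bij_betw f A {1..card A}} = fact (card A)"
proof -
  have "{f \<in> extensional A. bij_betw f A {1..card A}} =
      {f \<in> A \<rightarrow>\<^sub>E {1..card A}. inj_on f A}"
  proof (intro equalityI subsetI)
    fix f assume f: "f \<in> {f \<in> A \<rightarrow>\<^sub>E {1..card A}. inj_on f A}"
    then have "f ` A \<subseteq> {1..card A}" and "card (f ` A) = card {1..card A}"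
      by (auto simp: card_image)
    then have "f ` A = {1..card A}"
      by (intro card_subset_eq) auto
    with f show "f \<in> {f \<in> extensional A. bij_betw f A {1..card A}}"
      by (auto simp: bij_betw_def PiE_def)
  qed (auto simp: bij_betw_def PiE_def)
  then show ?thesis
    using card_inj_on_subset_funcset[of A "{1..card A}" A] assms
    by (simp add: fact_prod_rev atLeast0LessThan)
qed

text \<open>Restriction to the blocks identifies these functions with independent choices of one
  bijection per block.\<close>

lemma card_blockwise_bijections:
  assumes "finite I" "\<And>i. i \<in> I \<Longrightarrow> finite (B i)" "disjoint_family_on B I"
  shows "card {f \<in> extensional (\<Union>i\<in>I. B i). \<forall>i\<in>I. bij_betw f (B i) {1..card (B i)}} =
    (\<Prod>i\<in>I. fact (card (B i)))"
proof -
  let ?U = "\<Union>i\<in>I. B i"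
  let ?F = "{f \<in> extensional ?U. \<forall>i\<in>I. bij_betw f (B i) {1..card (B i)}}"
  let ?P = "PiE I (\<lambda>i. {f \<in> extensional (B i). bij_betw f (B i) {1..card (B i)}})"
  let ?r = "\<lambda>f. \<lambda>i\<in>I. restrict f (B i)"
  have "bij_betw ?r ?F ?P"
  proof (rule bij_betw_imageI)
    show "inj_on ?r ?F"
    proof (rule inj_onI)
      fix f g assume fg: "f \<in> ?F" "g \<in> ?F" "?r f = ?r g"
      show "f = g"
      proof (rule extensionalityI[of _ ?U])
        fix x assume "x \<in> ?U"
        then obtain i where i: "i \<in> I" "x \<in> B i" by blast
        have "?r f i x = ?r g i x"
          using fg(3) by simp
        with i show "f x = g x" by simp
      qed (use fg in auto)
    qed
    show "?r ` ?F = ?P"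
    proof (intro equalityI subsetI)
      fix x assume "x \<in> ?r ` ?F"
      then show "x \<in> ?P"
        by (auto simp: bij_betw_restrict_eq)
    next
      fix q assume q: "q \<in> ?P"
      \<comment> \<open>The inverse of restriction glues the components of \<open>q\<close>:
        \<open>THE\<close> selects the block containing \<open>x\<close>, which is unique by
        disjointness.\<close>
      define f where "f = (\<lambda>x\<in>?U. q (THE i. i \<in> I \<and> x \<in> B i) x)"
      have f: "f x = q i x" if "i \<in> I" "x \<in> B i" for i x
      proof -
        have "(THE i. i \<in> I \<and> x \<in> B i) = i"
          using that assms(3) by (intro the_equality) (auto simp: disjoint_family_on_def)
        then show ?thesis
          using that by (auto simp: f_def)
      qed
      have "bij_betw f (B i) {1..card (B i)}" if "i \<in> I" for i
        using q that f[OF that] bij_betw_cong[of "B i" f "q i"] by auto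
      then have "f \<in> ?F"
        by (auto simp: f_def)
      moreover have "?r f = q"
      proof
        fix i show "?r f i = q i"
        proof (cases "i \<in> I")
          case True
          then have "q i \<in> extensional (B i)"
            using q by auto
          with True f[OF True] show ?thesis
            by (auto simp: restrict_def extensional_def fun_eq_iff)
        next
          case False
          then show ?thesis
            using q by (auto simp: PiE_def extensional_def)
        qed
      qed
      ultimately show "q \<in> ?r ` ?F" by blast
    qed
  qed
  then have "card ?F = card ?P"
    by (rule bij_betw_same_card)
  also have "\<dots> = (\<Prod>i\<in>I. fact (card (B i)))"
    using assms(1,2) card_bijections_onto_initial_segment[of "B i" for i]
    by (simp add: card_PiE cong: prod.cong)
  finally show ?thesis .
qed

lemma wtree_finite_vertices: "wtree T \<Longrightarrow> finite (vertices T)"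
  by (simp add: wtree_def bicolored_plane_tree_def bicolored_plane_graph_def)

text \<open>The blocks are the groups of equal color and weight, whose sizes are the multiplicities
  in \<open>K\<close> and \<open>L\<close>.\<close>

lemma card_vertex_labelings:
  assumes "T \<in> wtrees_of_type K L"
  shows "card (vertex_labelings T) =
    (\<Prod>k\<in>set_mset K. fact (count K k)) * (\<Prod>l\<in>set_mset L. fact (count L l))"
proof -
  have T: "wtree T" "image_mset (vweight T) (mset_set (white T)) = K"
    "image_mset (vweight T) (mset_set (black T)) = L"
    using assms by (auto simp: wtrees_of_type_def)
  have fin: "finite (white T)" "finite (black T)"
    using wtree_finite_vertices[OF T(1)] by (auto simp: vertices_def)
  have disj: "white T \<inter> black T = {}"
    using T(1) by (simp add: wtree_def bicolored_plane_tree_def bicolored_plane_graph_def)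
  have count: "card {v \<in> S. vweight T v = k} = count (image_mset (vweight T) (mset_set S)) k"
    if "finite S" for S k
    using that by (auto simp: count_image_mset intro!: arg_cong[of _ _ card])
  \<comment> \<open>The same weight may occur in both colors; the sum type keeps the white and the
    black group of that weight apart.\<close>
  define I where "I = Inl ` set_mset K \<union> Inr ` set_mset L"
  define B where "B = case_sum (\<lambda>k. {v \<in> white T. vweight T v = k})
    (\<lambda>l. {v \<in> black T. vweight T v = l})"
  have K: "set_mset K = vweight T ` white T" and L: "set_mset L = vweight T ` black T"
    using T(2,3) fin by auto
  have "(\<Union>i\<in>I. B i) = vertices T"
    by (auto simp: I_def B_def K L vertices_def)
  moreover have "labeling T f \<longleftrightarrow> (\<forall>i\<in>I. bij_betw f (B i) {1..card (B i)})" for f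
  proof -
    \<comment> \<open>A weight that does not occur has an empty group, numbered by the empty
      interval \<open>{1..0}\<close>; its condition in \<open>labeling\<close> holds for every
      function, which leaves the blocks in \<open>I\<close>.\<close>
    have "bij_betw f {v \<in> white T. vweight T v = k} {1..card {v \<in> white T. vweight T v = k}}"
      if "k \<notin> set_mset K" for k
    proof -
      have "{v \<in> white T. vweight T v = k} = {}"
        using that by (auto simp: K)
      then show ?thesis by (simp only: bij_betw_def) simp
    qed
    moreover have
      "bij_betw f {v \<in> black T. vweight T v = k} {1..card {v \<in> black T. vweight T v = k}}"
      if "k \<notin> set_mset L" for k
    proof -
      have "{v \<in> black T. vweight T v = k} = {}"
        using that by (auto simp: L)
      then show ?thesis by (simp only: bij_betw_def) simp
    qed
    ultimately show ?thesis
      unfolding labeling_def I_def B_def ball_Un ball_simps sum.case by blast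
  qed
  ultimately have "vertex_labelings T =
      {f \<in> extensional (\<Union>i\<in>I. B i). \<forall>i\<in>I. bij_betw f (B i) {1..card (B i)}}"
    by (simp add: vertex_labelings_def)
  moreover have "disjoint_family_on B I"
    using disj by (auto simp: disjoint_family_on_def B_def split: sum.splits)
  moreover have "finite (B i)" for i
    using fin by (auto simp: B_def split: sum.splits)
  ultimately have "card (vertex_labelings T) = (\<Prod>i\<in>I. fact (card (B i)))"
    using card_blockwise_bijections[of I B] by (simp add: I_def)
  also have "\<dots> = (\<Prod>k\<in>set_mset K. fact (card (B (Inl k)))) *
      (\<Prod>l\<in>set_mset L. fact (card (B (Inr l))))"
    unfolding I_def by (subst prod.union_disjoint) (auto simp: prod.reindex)
  finally show ?thesis
    using count fin T(2,3) by (simp add: B_def)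
qed

section \<open>The action of symmetries on labelings\<close>

lemma labeling_cong:
  assumes "\<And>v. v \<in> vertices T \<Longrightarrow> lab v = lab' v"
  shows "labeling T lab \<longleftrightarrow> labeling T lab'"
proof -
  have "bij_betw lab S R \<longleftrightarrow> bij_betw lab' S R" if "S \<subseteq> vertices T" for S R
    using assms that by (intro bij_betw_cong) auto
  then show ?thesis
    unfolding labeling_def vertices_def by (simp add: Collect_conj_eq le_supI1 le_supI2 le_infI1)
qed

text \<open>Labelings pull back along \<open>h\<close>, because \<open>h\<close> maps each group of
  equal color and weight bijectively onto the corresponding group of \<open>T'\<close>.\<close>

lemma labeling_comp:
  assumes "orientation_preserving_homeo h" "carries h T T'" "labeling T' lab"
  shows "labeling T (lab \<circ> h)"
proof -
  have "inj h"
    using orientation_preserving_homeo_inverse[OF assms(1)] by (metis inj_on_id inj_on_imageI2)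
  then have inj: "inj_on h S" for S
    by (rule inj_on_subset) simp
  have w: "bij_betw h {v \<in> white T. vweight T v = k} {v \<in> white T'. vweight T' v = k}" for k
  proof (rule bij_betw_imageI[OF inj])
    have "white T' = h ` white T" "\<And>v. v \<in> white T \<Longrightarrow> vweight T' (h v) = vweight T v"
      using assms(2) by (auto simp: carries_def vertices_def)
    then show "h ` {v \<in> white T. vweight T v = k} = {v \<in> white T'. vweight T' v = k}"
      by auto
  qed
  have b: "bij_betw h {v \<in> black T. vweight T v = k} {v \<in> black T'. vweight T' v = k}" for k
  proof (rule bij_betw_imageI[OF inj])
    have "black T' = h ` black T" "\<And>v. v \<in> black T \<Longrightarrow> vweight T' (h v) = vweight T v"
      using assms(2) by (auto simp: carries_def vertices_def)
    then show "h ` {v \<in> black T. vweight T v = k} = {v \<in> black T'. vweight T' v = k}"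
      by auto
  qed
  show ?thesis
    unfolding labeling_def
    using assms(3) bij_betw_same_card[OF w] bij_betw_same_card[OF b]
    by (auto simp: labeling_def intro: bij_betw_trans[OF w] bij_betw_trans[OF b])
qed

text \<open>Two symmetries that take a labeling to the same labeling agree on the vertices, because the
  labeling separates vertices of equal color and weight.\<close>

lemma card_labelings_isotopic:
  assumes "wtree T" "labeling T lab"
  shows "card {lab' \<in> vertex_labelings T. labeled_isotopic (T, lab) (T, lab')} =
    card (symmetries T)"
proof -
  let ?V = "vertices T"
  let ?f = "\<lambda>s. restrict (lab \<circ> s) ?V"
  have disj: "white T \<inter> black T = {}"
    using assms(1) by (simp add: wtree_def bicolored_plane_tree_def bicolored_plane_graph_def)
  have "inj_on ?f (vertex_symmetries T)"
  proof (rule inj_onI)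
    fix s s' assume "s \<in> vertex_symmetries T" "s' \<in> vertex_symmetries T" and eq: "?f s = ?f s'"
    then obtain h k where h: "carries h T T" "s = restrict h ?V"
      and k: "carries k T T" "s' = restrict k ?V"
      by (auto simp: vertex_symmetries_def)
    have "h v = k v" if v: "v \<in> ?V" for v
    proof -
      have lab: "lab (h v) = lab (k v)"
        using fun_cong[OF eq, of v] v h(2) k(2) by simp
      have wt: "vweight T (h v) = vweight T v" "vweight T (k v) = vweight T v"
        using h(1) k(1) v by (auto simp: carries_def)
      show ?thesis
      proof (cases "v \<in> white T")
        case True
        then have "h v \<in> {u \<in> white T. vweight T u = vweight T v}"
          "k v \<in> {u \<in> white T. vweight T u = vweight T v}"
          using h(1) k(1) wt by (auto simp: carries_def)
        moreover have "inj_on lab {u \<in> white T. vweight T u = vweight T v}"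
          using assms(2) by (auto simp: labeling_def bij_betw_def)
        ultimately show ?thesis
          using lab by (auto dest: inj_onD)
      next
        case False
        then have "v \<in> black T"
          using v by (simp add: vertices_def)
        then have "h v \<in> {u \<in> black T. vweight T u = vweight T v}"
          "k v \<in> {u \<in> black T. vweight T u = vweight T v}"
          using h(1) k(1) wt by (auto simp: carries_def)
        moreover have "inj_on lab {u \<in> black T. vweight T u = vweight T v}"
          using assms(2) by (auto simp: labeling_def bij_betw_def)
        ultimately show ?thesis
          using lab by (auto dest: inj_onD)
      qed
    qed
    then show "s = s'"
      using h(2) k(2) by (auto intro: restrict_ext)
  qed
  moreover have "?f ` vertex_symmetries T =
      {lab' \<in> vertex_labelings T. labeled_isotopic (T, lab) (T, lab')}"
  proof (intro equalityI subsetI)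
    fix l assume "l \<in> ?f ` vertex_symmetries T"
    then obtain h where h: "orientation_preserving_homeo h" "carries h T T"
      and l: "l = restrict (lab \<circ> h) ?V"
      by (auto simp: vertex_symmetries_def restrict_def fun_eq_iff)
    have "labeling T (lab \<circ> h)"
      by (rule labeling_comp[OF h assms(2)])
    then have "labeling T l"
      using labeling_cong[of T l "lab \<circ> h"] l by simp
    \<comment> \<open>The symmetry \<open>h\<close> leads from the pulled-back labeling to
      \<open>lab\<close>; the required direction follows by symmetry of the relation.\<close>
    moreover have "labeled_isotopic (T, l) (T, lab)"
      unfolding labeled_isotopic_def using h l by auto
    ultimately show "l \<in> {lab' \<in> vertex_labelings T. labeled_isotopic (T, lab) (T, lab')}"
      using l labeled_isotopic_sym by (auto simp: vertex_labelings_def)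
  next
    fix l assume l: "l \<in> {lab' \<in> vertex_labelings T. labeled_isotopic (T, lab) (T, lab')}"
    then have "labeled_isotopic (T, l) (T, lab)"
      using labeled_isotopic_sym by blast
    then obtain h where h: "orientation_preserving_homeo h" "carries h T T"
      "\<forall>v\<in>?V. lab (h v) = l v"
      by (auto simp: labeled_isotopic_def)
    have "l = ?f (restrict h ?V)"
      using l h(3) by (intro extensionalityI[of _ ?V]) (auto simp: vertex_labelings_def)
    then show "l \<in> ?f ` vertex_symmetries T"
      using h by (auto simp: vertex_symmetries_def)
  qed
  ultimately show ?thesis
    by (metis card_image card_symmetries[OF assms(1)])
qed

section \<open>Elements of the derivative type over a class of w-trees\<close>

definition labeled_class ::
  "nat multiset \<Rightarrow> nat multiset \<Rightarrow> labeled_wgraph \<Rightarrow> labeled_wgraph set" where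
  "labeled_class K L X = {X' \<in> labeled_wtrees_of_type K L. labeled_isotopic X X'}"

definition wtree_class :: "nat multiset \<Rightarrow> nat multiset \<Rightarrow> wgraph \<Rightarrow> wgraph set" where
  "wtree_class K L T = {T' \<in> wtrees_of_type K L. isotopic T T'}"

lemma labeled_isotopic_Image:
  assumes "X \<in> labeled_wtrees_of_type K L"
  shows "{(X, X'). X \<in> labeled_wtrees_of_type K L \<and> X' \<in> labeled_wtrees_of_type K L \<and>
    labeled_isotopic X X'} `` {X} = labeled_class K L X"
  unfolding labeled_class_def Image_singleton using assms by simp

lemma isotopic_Image:
  assumes "T \<in> wtrees_of_type K L"
  shows "{(T, T'). T \<in> wtrees_of_type K L \<and> T' \<in> wtrees_of_type K L \<and> isotopic T T'} `` {T} =
    wtree_class K L T"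
  unfolding wtree_class_def Image_singleton using assms by simp

lemma derivative_type_eq:
  "derivative_type K L = labeled_class K L ` labeled_wtrees_of_type K L"
  unfolding derivative_type_def quotient_def UNION_singleton_eq_range
  by (intro image_cong refl labeled_isotopic_Image)

lemma type_classes_eq: "type_classes K L = wtree_class K L ` wtrees_of_type K L"
  unfolding type_classes_def quotient_def UNION_singleton_eq_range
  by (intro image_cong refl isotopic_Image)

lemma labeled_class_eq_iff:
  assumes "X \<in> labeled_wtrees_of_type K L" "X' \<in> labeled_wtrees_of_type K L"
  shows "labeled_class K L X = labeled_class K L X' \<longleftrightarrow> labeled_isotopic X X'"
  using eq_equiv_class_iff[OF equiv_labeled_isotopic assms] assms
  unfolding labeled_isotopic_Image[OF assms(1)] labeled_isotopic_Image[OF assms(2)] by simp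

text \<open>Labels can be transported along any isotopy, so forgetting them turns a labeled class
  into a full class of w-trees. Thus the image under \<open>fst\<close> is the projection from the
  derivative type to the type.\<close>

lemma fst_labeled_class:
  assumes "(T, lab) \<in> labeled_wtrees_of_type K L"
  shows "fst ` labeled_class K L (T, lab) = wtree_class K L T"
proof (intro equalityI subsetI)
  fix T' assume "T' \<in> fst ` labeled_class K L (T, lab)"
  then obtain lab' where "(T', lab') \<in> labeled_class K L (T, lab)"
    by force
  then show "T' \<in> wtree_class K L T"
    by (auto simp: labeled_class_def wtree_class_def labeled_wtrees_of_type_def
        labeled_isotopic_def isotopic_def)
next
  fix T' assume "T' \<in> wtree_class K L T"
  then obtain h where T': "T' \<in> wtrees_of_type K L"
    and h: "orientation_preserving_homeo h" "carries h T T'"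
    by (auto simp: wtree_class_def isotopic_def)
  obtain k where k: "orientation_preserving_homeo k" "k \<circ> h = id"
    using orientation_preserving_homeo_inverse[OF h(1)] by metis
  \<comment> \<open>The labeling is pushed forward along \<open>h\<close> by pulling it back along
    the inverse \<open>k\<close>.\<close>
  have "labeling T' (lab \<circ> k)"
    using labeling_comp[OF k(1) carries_inverse[OF h(2) k(2)]] assms
    by (auto simp: labeled_wtrees_of_type_def)
  moreover have "labeled_isotopic (T, lab) (T', lab \<circ> k)"
    using h k(2) by (auto simp: labeled_isotopic_def fun_eq_iff)
  ultimately have "(T', lab \<circ> k) \<in> labeled_class K L (T, lab)"
    using T' by (auto simp: labeled_class_def labeled_wtrees_of_type_def)
  then show "T' \<in> fst ` labeled_class K L (T, lab)"
    by force
qed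

text \<open>A labeled class that projects to the class of \<open>T\<close> contains a labeling of
  \<open>T\<close> itself, and changing that labeling off the vertices stays within the
  class.\<close>

lemma labeled_classes_over_wtree_class:
  assumes "T \<in> wtrees_of_type K L"
  shows "{C \<in> derivative_type K L. fst ` C = wtree_class K L T} =
    (\<lambda>lab. labeled_class K L (T, lab)) ` vertex_labelings T"
proof (intro equalityI subsetI)
  fix C assume C: "C \<in> {C \<in> derivative_type K L. fst ` C = wtree_class K L T}"
  have "T \<in> wtree_class K L T"
    using assms orientation_preserving_homeo_id carries_id
    by (auto simp: wtree_class_def isotopic_def)
  then obtain lab where lab: "(T, lab) \<in> C"
    using C by force
  obtain X where X: "X \<in> labeled_wtrees_of_type K L" "C = labeled_class K L X"
    using C by (auto simp: derivative_type_eq)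
  have Tl: "(T, lab) \<in> labeled_wtrees_of_type K L" "labeled_isotopic X (T, lab)"
    using lab X by (auto simp: labeled_class_def)
  define l where "l = restrict lab (vertices T)"
  have l: "labeling T l"
    using Tl(1) labeling_cong[of T l lab] by (auto simp: l_def labeled_wtrees_of_type_def)
  then have Tl': "(T, l) \<in> labeled_wtrees_of_type K L"
    using assms by (simp add: labeled_wtrees_of_type_def)
  have "labeled_isotopic (T, lab) (T, l)"
    unfolding labeled_isotopic_def
    using orientation_preserving_homeo_id carries_id by (intro exI[of _ id]) (auto simp: l_def)
  then have "C = labeled_class K L (T, l)"
    using labeled_class_eq_iff[OF X(1) Tl'] labeled_isotopic_trans Tl(2) X(2) by blast
  moreover have "l \<in> vertex_labelings T"
    using l by (simp add: vertex_labelings_def l_def)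
  ultimately show "C \<in> (\<lambda>lab. labeled_class K L (T, lab)) ` vertex_labelings T"
    by blast
next
  fix C assume "C \<in> (\<lambda>lab. labeled_class K L (T, lab)) ` vertex_labelings T"
  then obtain lab where "(T, lab) \<in> labeled_wtrees_of_type K L" "C = labeled_class K L (T, lab)"
    using assms by (auto simp: vertex_labelings_def labeled_wtrees_of_type_def)
  then show "C \<in> {C \<in> derivative_type K L. fst ` C = wtree_class K L T}"
    using fst_labeled_class by (auto simp: derivative_type_eq)
qed

text \<open>Orbit counting: the labelings of \<open>T\<close> split into isotopy classes, each with
  as many labelings as \<open>T\<close> has symmetries.\<close>

lemma card_labeled_classes_times_symmetries:
  assumes "T \<in> wtrees_of_type K L"
  shows "card {C \<in> derivative_type K L. fst ` C = wtree_class K L T} * card (symmetries T) =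
    (\<Prod>k\<in>set_mset K. fact (count K k)) * (\<Prod>l\<in>set_mset L. fact (count L l))"
proof -
  let ?V = "vertex_labelings T"
  let ?c = "\<lambda>lab. labeled_class K L (T, lab)"
  let ?p = "(\<Prod>k\<in>set_mset K. fact (count K k)) * (\<Prod>l\<in>set_mset L. fact (count L l)) :: nat"
  have p: "card ?V = ?p"
    using card_vertex_labelings[OF assms] .
  have "?p > 0"
    by (simp add: prod_pos)
  \<comment> \<open>A positive \<open>card\<close> excludes infinite sets.\<close>
  then have fin: "finite ?V"
    using p by (metis card_gt_0_iff)
  have lab: "(T, lab) \<in> labeled_wtrees_of_type K L" if "lab \<in> ?V" for lab
    using that assms by (auto simp: vertex_labelings_def labeled_wtrees_of_type_def)
  have "card {lab' \<in> ?V. ?c lab' = C} = card (symmetries T)" if C: "C \<in> ?c ` ?V" for C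
  proof -
    obtain lab where l: "lab \<in> ?V" "C = ?c lab"
      using C by blast
    have "{lab' \<in> ?V. ?c lab' = C} = {lab' \<in> ?V. labeled_isotopic (T, lab) (T, lab')}"
      using labeled_class_eq_iff[OF lab lab] l by blast
    then show ?thesis
      using card_labelings_isotopic[of T lab] assms l(1)
      by (simp add: wtrees_of_type_def vertex_labelings_def)
  qed
  then have "card ?V = (\<Sum>C\<in>?c ` ?V. card (symmetries T))"
    using sum.image_gen[OF fin, of "\<lambda>_. 1::nat" ?c] by simp
  then show ?thesis
    using labeled_classes_over_wtree_class[OF assms] p by simp
qed

lemma derivative_type_representative:
  assumes "C \<in> derivative_type K L"
  shows "\<exists>T lab. (T, lab) \<in> C \<and> T \<in> wtrees_of_type K L \<and> fst ` C = wtree_class K L T"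
proof -
  obtain T lab where X: "(T, lab) \<in> labeled_wtrees_of_type K L" "C = labeled_class K L (T, lab)"
    using assms unfolding derivative_type_eq by auto
  then have "(T, lab) \<in> C"
    using labeled_isotopic_refl by (simp add: labeled_class_def)
  moreover have "T \<in> wtrees_of_type K L"
    using X(1) by (simp add: labeled_wtrees_of_type_def)
  ultimately show ?thesis
    using fst_labeled_class[OF X(1)] unfolding X(2) by (intro exI conjI)
qed

section \<open>Summing the symmetry orders over the derivative type\<close>

theorem theorem4:
  fixes K L :: "nat multiset" and N p :: nat and M :: "nat \<Rightarrow> nat"
  assumes "is_type K L" and "\<not> simple_type K L"
    and "p = (\<Prod>k\<in>set_mset K. fact (count K k)) * (\<Prod>l\<in>set_mset L. fact (count L l))"
    and "finite (nonsymmetric_elements K L) \<and> card (nonsymmetric_elements K L) = N"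
    and "\<And>i. i \<ge> 2 \<Longrightarrow> finite (symmetric_elements i K L) \<and> card (symmetric_elements i K L) = M i"
  shows "finite (type_classes K L) \<and> finite {i. i \<ge> 2 \<and> M i \<noteq> 0} \<and>
    real (card (type_classes K L)) =
      real N / real p + (\<Sum>i | i \<ge> 2 \<and> M i \<noteq> 0. real i * real (M i) / real p)"
proof -
  let ?D = "derivative_type K L"
  define F where "F c = {C \<in> ?D. fst ` C = c}" for c
  have p_pos: "p > 0"
    using assms(3) by (simp add: prod_pos)
  have fibre: "card (F (wtree_class K L T)) * card (symmetries T) = p"
    if "T \<in> wtrees_of_type K L" for T
    using card_labeled_classes_times_symmetries[OF that] assms(3) by (simp add: F_def)
  \<comment> \<open>One family covers both kinds of counted sets: \<open>E 1\<close> holds the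
    nonsymmetric elements and \<open>E i\<close> with \<open>i \<ge> 2\<close> those of order
    \<open>i\<close>.\<close>
  define E where "E i = {C \<in> ?D. \<forall>(T, lab)\<in>C. card (symmetries T) = i}" for i
  have E1: "E 1 = nonsymmetric_elements K L"
    by (simp add: E_def nonsymmetric_elements_def nonsymmetric_iff_card_symmetries)
  have E2: "E i = symmetric_elements i K L" for i
    by (simp add: E_def symmetric_elements_def)
  \<comment> \<open>The fibre over a class does not depend on its representative; hence neither does the order
    of the symmetry group, and no conjugation of symmetries is needed.\<close>
  have sym_eq: "card (symmetries T) = p div card (F (fst ` C))"
    and sym_range: "card (symmetries T) \<in> {1..p}"
    if "C \<in> ?D" "(T, lab) \<in> C" for C T lab
  proof -
    obtain T0 lab0 where T0: "T0 \<in> wtrees_of_type K L" "fst ` C = wtree_class K L T0"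
      using derivative_type_representative \<open>C \<in> ?D\<close> by blast
    have "T \<in> fst ` C"
      using that(2) by force
    then have T: "T \<in> wtrees_of_type K L" "isotopic T0 T"
      using T0(2) by (auto simp: wtree_class_def)
    have "wtree_class K L T0 = wtree_class K L T"
      using eq_equiv_class_iff[OF equiv_isotopic T0(1) T(1)] T0(1) T
      unfolding isotopic_Image[OF T0(1)] isotopic_Image[OF T(1)] by simp
    \<comment> \<open>The fibre equation holds for every representative \<open>T\<close> of the same
      class, with the same fibre; so it fixes the symmetry order and bounds it by
      \<open>p\<close>.\<close>
    then have *: "card (F (fst ` C)) * card (symmetries T) = p"
      using fibre[OF T(1)] T0(2) by simp
    then have "card (F (fst ` C)) > 0"
      using p_pos by (metis gr0I mult_zero_left)
    then show "card (symmetries T) = p div card (F (fst ` C))"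
      using * by auto
    show "card (symmetries T) \<in> {1..p}"
      using * p_pos by (auto simp: Suc_le_eq intro: gr0I)
  qed
  \<comment> \<open>The symmetry order as a function of the class alone, without choosing a
    representative.\<close>
  define s where "s C = p div card (F (fst ` C))" for C :: "labeled_wgraph set"
  \<comment> \<open>The condition in \<open>E\<close> ranges over all members of \<open>C\<close>.
    Since \<open>C\<close> is nonempty it is not vacuous, and since all members have symmetry order
    \<open>s C\<close>, one of them decides it.\<close>
  have s_E: "C \<in> E i \<longleftrightarrow> s C = i" and s_range: "s C \<in> {1..p}" if "C \<in> ?D" for C i
  proof -
    obtain T lab where "(T, lab) \<in> C"
      using derivative_type_representative \<open>C \<in> ?D\<close> by blast
    then show "C \<in> E i \<longleftrightarrow> s C = i" "s C \<in> {1..p}"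
      using sym_eq sym_range that unfolding E_def s_def by fastforce+
  qed
  have finE: "finite (E i)" if "i \<ge> 1" for i
    using that assms(4,5) E1 E2 by (cases "i = 1") auto
  \<comment> \<open>The orders lie between 1 and \<open>p\<close>, so finitely many sets
    \<open>E i\<close> with \<open>i \<ge> 1\<close>, each finite by assumption, exhaust the
    derivative type.\<close>
  have D: "?D = (\<Union>i\<in>{1..p}. E i)"
    using s_E s_range by (auto simp: E_def)
  then have finD: "finite ?D"
    using finE by auto
  \<comment> \<open>No order exceeds \<open>p\<close>, so the sum over all orders has only finitely
    many nonzero terms.\<close>
  have M_zero: "M i = 0" if "i \<ge> 2" "i > p" for i
  proof -
    have "C \<notin> E i" for C
    proof
      assume C: "C \<in> E i"
      then have "C \<in> ?D"
        by (simp add: E_def)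
      then show False
        using s_E s_range C that(2) by (metis atLeastAtMost_iff not_le)
    qed
    then have "E i = {}"
      by blast
    then show ?thesis
      using assms(5)[OF that(1)] E2 by (metis card.empty)
  qed
  then have sub: "{i. i \<ge> 2 \<and> M i \<noteq> 0} \<subseteq> {2..p}"
    by (metis (mono_tags, lifting) atLeastAtMost_iff mem_Collect_eq not_le subsetI)
  \<comment> \<open>Every class of w-trees receives total weight \<open>p\<close>: the fibre size
    divides \<open>p\<close>, and each element of the fibre has the complementary factor as its
    weight. Nonemptiness gives surjectivity of the projection in \<open>img\<close>.\<close>
  have F_sum: "F c \<noteq> {} \<and> (\<Sum>C\<in>F c. real (s C)) = real p" if c: "c \<in> type_classes K L" for c
  proof -
    obtain T where T: "T \<in> wtrees_of_type K L" "c = wtree_class K L T"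
      using c by (auto simp: type_classes_eq)
    have "card (F c) > 0" "card (F c) dvd p"
      using fibre[OF T(1)] p_pos T(2) by (metis gr0I mult_zero_left, metis dvd_triv_left)
    moreover have "(\<Sum>C\<in>F c. real (s C)) = real (card (F c)) * real (p div card (F c))"
      by (simp add: F_def s_def)
    ultimately show ?thesis
      by (auto simp flip: of_nat_mult)
  qed
  have img: "(`) fst ` ?D = type_classes K L"
  proof (intro equalityI subsetI)
    fix c assume "c \<in> (`) fst ` ?D"
    then obtain C where C: "C \<in> ?D" "c = fst ` C"
      by (elim imageE) (rule that)
    then obtain T where "T \<in> wtrees_of_type K L" "c = wtree_class K L T"
      using derivative_type_representative[OF C(1)] by metis
    then show "c \<in> type_classes K L"
      unfolding type_classes_eq by simp
  next
    fix c assume "c \<in> type_classes K L"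
    then obtain C where "C \<in> F c"
      using F_sum by blast
    then have "C \<in> ?D" "c = fst ` C"
      by (simp_all add: F_def)
    then show "c \<in> (`) fst ` ?D"
      by (rule rev_image_eqI)
  qed
  have finT: "finite (type_classes K L)"
    using finD img by (metis finite_imageI)
  \<comment> \<open>Double counting of the total weight of the derivative type: first by the
    underlying class, then by symmetry order.\<close>
  have "real (card (type_classes K L)) * real p = (\<Sum>c\<in>type_classes K L. \<Sum>C\<in>F c. real (s C))"
    using F_sum by simp
  also have "\<dots> = (\<Sum>C\<in>?D. real (s C))"
    using sum.image_gen[OF finD, of "\<lambda>C. real (s C)" "(`) fst"] img by (simp add: F_def)
  also have "\<dots> = (\<Sum>i\<in>{1..p}. \<Sum>C | C \<in> ?D \<and> s C = i. real (s C))"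
    using s_range by (intro sum.group[symmetric] finD) auto
  also have "\<dots> = (\<Sum>i\<in>{1..p}. real i * real (card (E i)))"
  proof (rule sum.cong[OF refl])
    fix i
    have "E i \<subseteq> ?D"
      by (simp add: E_def)
    then have E: "E i = {C. C \<in> ?D \<and> s C = i}"
      using s_E by blast
    show "(\<Sum>C | C \<in> ?D \<and> s C = i. real (s C)) = real i * real (card (E i))"
      unfolding E by simp
  qed
  \<comment> \<open>The term for order 1 is split off; it counts the nonsymmetric elements.\<close>
  also have "\<dots> = real N + (\<Sum>i\<in>{2..p}. real i * real (card (E i)))"
    using p_pos E1 assms(4) by (simp add: sum.atLeast_Suc_atMost numeral_2_eq_2)
  also have "(\<Sum>i\<in>{2..p}. real i * real (card (E i))) = (\<Sum>i\<in>{2..p}. real i * real (M i))"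
    using assms(5) E2 by simp
  also have "\<dots> = (\<Sum>i | i \<ge> 2 \<and> M i \<noteq> 0. real i * real (M i))"
    using sub by (intro sum.mono_neutral_right) auto
  finally have "real (card (type_classes K L)) =
      (real N + (\<Sum>i | i \<ge> 2 \<and> M i \<noteq> 0. real i * real (M i))) / real p"
    using p_pos by (simp add: field_simps)
  then show ?thesis
    using finT finite_subset[OF sub] by (simp add: add_divide_distrib sum_divide_distrib)
qed

end
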